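(* Let $\mathcal T=(\mathbb T,\mathcal V,\xi)$ be a topological theory with $\bot\neq k$ in $\mathcal V$. Let $X=(X,a)$ be a $\mathcal T$-category where $a=a_0\cdot\alpha$ for some map $\alpha:TX\to X$. Then the following assertions are equivalent. (i) The $\mathcal T$-graph $X^{\mathrm{op}}=(X,a_0^\circ\cdot\alpha)$ is actually a $\mathcal T$-category. (ii) $X$ is core-compact. (iii) $X$ is representable.
   Context: **Theory.** A topological theory $\mathcal T=(\mathbb T,\mathcal V,\xi)$ consists of a monad $\mathbb T=(T,e,m)$ on $\mathsf{Set}$, a commutative unital quantale $\mathcal V=(\mathcal V,\otimes,k)$ (complete lattice, commutative monoid, $\otimes$ preserves suprema in each variable) and a map $\xi:T\mathcal V\to\mathcal V$ such that (a) $T$ preserves weak pullbacks and every naturality square of $m$ is a weak pullback; (b) $(\mathcal V,\xi)$ is an Eilenberg–Moore $\mathbb T$-algebra, $\xi\cdot T(\otimes)=\otimes\cdot\langle\xi\cdot T\pi_1,\xi\cdot T\pi_2\rangle$ on $T(\mathcal V\times\mathcal V)$, and $\xi\cdot T(k)$ is constant $k$ on $T1$ (with $k:1\to\mathcal V$); (c) for every map $f:X\to Y$ and $\varphi:X\to\mathcal V$, $\xi\cdot T(f_!\varphi)=(Tf)_!(\xi\cdot T\varphi)$, where $f_!\varphi(y)=\bigvee_{f(x)=y}\varphi(x)$. **Relations.** A $\mathcal V$-relation $r:X\nrightarrow Y$ is a map $X\times Y\to\mathcal V$, ordered pointwise; $(s\cdot r)(x,z)=\bigvee_y r(x,y)\otimes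 s(y,z)$; $r^\circ(y,x)=r(x,y)$; a map $f$ is identified with the relation with value $k$ if $f(x)=y$ and $\bot$ otherwise. $T_\xi r:TX\nrightarrow TY$ is $T_\xi r(\mathfrak x,\mathfrak y)=\bigvee\{\xi\cdot Tr(\mathfrak w)\mid \mathfrak w\in T(X\times Y),T\pi_1(\mathfrak w)=\mathfrak x,T\pi_2(\mathfrak w)=\mathfrak y\}$. **$\mathcal T$-categories.** A $\mathcal T$-graph is $(X,a)$ with $a:TX\nrightarrow X$ and $e_X^\circ\le a$; it is a $\mathcal T$-category if moreover $a\cdot T_\xi a\cdot m_X^\circ\le a$. A $\mathcal T$-functor $f:(X,a)\to(Y,b)$ is a map with $a(\mathfrak x,x)\le b(Tf(\mathfrak x),f(x))$. Put $a_0=a\cdot e_X:X\nrightarrow X$. For $\mathcal T$-functors $f,g$ into $(Y,b)$: $f\le g$ iff $k\le b_0(f(x),g(x))$ for all $x$; $f\dashv g$ means $1\le gf$ and $fg\le 1$. $X=(X,a)$ is core-compact if $a\cdot T_\xi a=a\cdot m_X$. $TX$ carries the $\mathcal T$-category structure $T_\xi a\cdot m_X^\circ\cdot m_X$, and $X$ is representable if the $\mathcal T$-functor $e_X:X\to TX$ has a left adjoint in $\mathcal T\text{-}\mathsf{Cat}$. The $\mathcal T$-graph $X^{\mathrm{op}}=(X,a_0^\circ\cdot\alpha)$ does not depend on the choice of $\alpha$ with $a=a_0\cdot\alpha$. *)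

theory Defs
  imports "HOL-Library.FuncSet"
begin

section \<open>Sets, functors and monads\<close>

text \<open>
  HOL has no variable ranging over type constructors, so the category of sets is the category of
  the sets belonging to a universe \<open>Ob\<close> of subsets of a type, with all functions between them as
  arrows. Of the universe we only ask that it is closed under subsets and (encoded) binary
  products; Grothendieck universes are instances. A function \<open>A \<rightarrow> B\<close> is an element of
  \<^term>\<open>A \<rightarrow> B\<close>, and two of them represent the same arrow iff they agree on \<open>A\<close>.
\<close>

record 'u set_category =
  Ob :: "'u set set"
  pair :: "'u \<times> 'u \<Rightarrow> 'u"

definition times :: "('u, 'b) set_category_scheme \<Rightarrow> 'u set \<Rightarrow> 'u set \<Rightarrow> 'u set" where
  "times S A B = pair S ` (A \<times> B)"

definition proj1 :: "('u, 'b) set_category_scheme \<Rightarrow> 'u \<Rightarrow> 'u" where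
  "proj1 S w = fst (inv (pair S) w)"

definition proj2 :: "('u, 'b) set_category_scheme \<Rightarrow> 'u \<Rightarrow> 'u" where
  "proj2 S w = snd (inv (pair S) w)"

locale set_category =
  fixes S :: "('u, 'b) set_category_scheme"
  assumes inj_pair: "inj (pair S)"
    and subset_closed: "A \<in> Ob S \<Longrightarrow> B \<subseteq> A \<Longrightarrow> B \<in> Ob S"
    and times_closed: "A \<in> Ob S \<Longrightarrow> B \<in> Ob S \<Longrightarrow> times S A B \<in> Ob S"

text \<open>
  The square with \<open>p : P \<rightarrow> A\<close>, \<open>q : P \<rightarrow> B\<close>, \<open>f : A \<rightarrow> C\<close>, \<open>g : B \<rightarrow> C\<close> is a weak pullback.
\<close>

definition weak_pullback ::
  "('u, 'b) set_category_scheme \<Rightarrow> 'u set \<Rightarrow> 'u set \<Rightarrow> 'u set \<Rightarrow> 'u set \<Rightarrow>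
    ('u \<Rightarrow> 'u) \<Rightarrow> ('u \<Rightarrow> 'u) \<Rightarrow> ('u \<Rightarrow> 'u) \<Rightarrow> ('u \<Rightarrow> 'u) \<Rightarrow> bool" where
  "weak_pullback S P A B C p q f g \<longleftrightarrow>
    P \<in> Ob S \<and> A \<in> Ob S \<and> B \<in> Ob S \<and> C \<in> Ob S \<and>
    p \<in> P \<rightarrow> A \<and> q \<in> P \<rightarrow> B \<and> f \<in> A \<rightarrow> C \<and> g \<in> B \<rightarrow> C \<and>
    (\<forall>x\<in>P. f (p x) = g (q x)) \<and>
    (\<forall>Q\<in>Ob S. \<forall>u\<in>Q \<rightarrow> A. \<forall>v\<in>Q \<rightarrow> B. (\<forall>x\<in>Q. f (u x) = g (v x)) \<longrightarrow>
      (\<exists>h\<in>Q \<rightarrow> P. \<forall>x\<in>Q. p (h x) = u x \<and> q (h x) = v x))"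

record 'u set_monad = "'u set_category" +
  Tob :: "'u set \<Rightarrow> 'u set"
  Tmap :: "'u set \<Rightarrow> 'u set \<Rightarrow> ('u \<Rightarrow> 'u) \<Rightarrow> 'u \<Rightarrow> 'u"
  eta :: "'u set \<Rightarrow> 'u \<Rightarrow> 'u"
  mu :: "'u set \<Rightarrow> 'u \<Rightarrow> 'u"

locale set_monad = set_category M
  for M :: "('u, 'b) set_monad_scheme" +
  assumes Tob_closed: "A \<in> Ob M \<Longrightarrow> Tob M A \<in> Ob M"
    and Tmap_closed:
      "A \<in> Ob M \<Longrightarrow> B \<in> Ob M \<Longrightarrow> f \<in> A \<rightarrow> B \<Longrightarrow> Tmap M A B f \<in> Tob M A \<rightarrow> Tob M B"
    and Tmap_cong:
      "A \<in> Ob M \<Longrightarrow> B \<in> Ob M \<Longrightarrow> f \<in> A \<rightarrow> B \<Longrightarrow> g \<in> A \<rightarrow> B \<Longrightarrow> (\<And>x. x \<in> A \<Longrightarrow> f x = g x) \<Longrightarrow>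
        t \<in> Tob M A \<Longrightarrow> Tmap M A B f t = Tmap M A B g t"
    and Tmap_id: "A \<in> Ob M \<Longrightarrow> t \<in> Tob M A \<Longrightarrow> Tmap M A A (\<lambda>x. x) t = t"
    and Tmap_comp:
      "A \<in> Ob M \<Longrightarrow> B \<in> Ob M \<Longrightarrow> C \<in> Ob M \<Longrightarrow> f \<in> A \<rightarrow> B \<Longrightarrow> g \<in> B \<rightarrow> C \<Longrightarrow> t \<in> Tob M A \<Longrightarrow>
        Tmap M A C (\<lambda>x. g (f x)) t = Tmap M B C g (Tmap M A B f t)"
    and eta_closed: "A \<in> Ob M \<Longrightarrow> eta M A \<in> A \<rightarrow> Tob M A"
    and eta_natural:
      "A \<in> Ob M \<Longrightarrow> B \<in> Ob M \<Longrightarrow> f \<in> A \<rightarrow> B \<Longrightarrow> x \<in> A \<Longrightarrow>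
        Tmap M A B f (eta M A x) = eta M B (f x)"
    and mu_closed: "A \<in> Ob M \<Longrightarrow> mu M A \<in> Tob M (Tob M A) \<rightarrow> Tob M A"
    and mu_natural:
      "A \<in> Ob M \<Longrightarrow> B \<in> Ob M \<Longrightarrow> f \<in> A \<rightarrow> B \<Longrightarrow> t \<in> Tob M (Tob M A) \<Longrightarrow>
        Tmap M A B f (mu M A t) = mu M B (Tmap M (Tob M A) (Tob M B) (Tmap M A B f) t)"
    and mu_eta: "A \<in> Ob M \<Longrightarrow> t \<in> Tob M A \<Longrightarrow> mu M A (eta M (Tob M A) t) = t"
    and mu_Tmap_eta: "A \<in> Ob M \<Longrightarrow> t \<in> Tob M A \<Longrightarrow> mu M A (Tmap M A (Tob M A) (eta M A) t) = t"
    and mu_assoc: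
      "A \<in> Ob M \<Longrightarrow> t \<in> Tob M (Tob M (Tob M A)) \<Longrightarrow>
        mu M A (mu M (Tob M A) t) = mu M A (Tmap M (Tob M (Tob M A)) (Tob M A) (mu M A) t)"


section \<open>Topological theories\<close>

text \<open>
  The quantale lives on a type \<open>'v\<close>, with the order of the class \<^class>\<open>complete_lattice\<close>. To apply
  \<open>T\<close> to it, its underlying set is embedded into the universe by the injection \<open>code\<close>;
  the map \<open>xi\<close> then only matters on \<open>T (range code)\<close>.
\<close>

record ('u, 'v) topological_theory = "'u set_monad" +
  tensor :: "'v \<Rightarrow> 'v \<Rightarrow> 'v"
  kunit :: 'v
  code :: "'v \<Rightarrow> 'u"
  xi :: "'u \<Rightarrow> 'v"

definition Vset :: "('u, 'v, 'b) topological_theory_scheme \<Rightarrow> 'u set" where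
  "Vset \<T> = range (code \<T>)"

definition decode :: "('u, 'v, 'b) topological_theory_scheme \<Rightarrow> 'u \<Rightarrow> 'v" where
  "decode \<T> = inv (code \<T>)"

text \<open>The function \<open>\<xi> \<cdot> T\<phi> : TX \<rightarrow> V\<close> for \<open>\<phi> : X \<rightarrow> V\<close>.\<close>

definition xi_T ::
  "('u, 'v, 'b) topological_theory_scheme \<Rightarrow> 'u set \<Rightarrow> ('u \<Rightarrow> 'v) \<Rightarrow> 'u \<Rightarrow> 'v" where
  "xi_T \<T> X \<phi> t = xi \<T> (Tmap \<T> X (Vset \<T>) (\<lambda>x. code \<T> (\<phi> x)) t)"

definition pushforward ::
  "'u set \<Rightarrow> ('u \<Rightarrow> 'u) \<Rightarrow> ('u \<Rightarrow> 'v::complete_lattice) \<Rightarrow> 'u \<Rightarrow> 'v" where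
  "pushforward X f \<phi> y = (SUP x\<in>{x \<in> X. f x = y}. \<phi> x)"

locale topological_theory = set_monad \<T> + comm_monoid "tensor \<T>" "kunit \<T>"
  for \<T> :: "('u, 'v::complete_lattice, 'b) topological_theory_scheme" +
  assumes tensor_Sup: "tensor \<T> u (Sup U) = (SUP v\<in>U. tensor \<T> u v)"
    and inj_code: "inj (code \<T>)"
    and Vset_Ob: "Vset \<T> \<in> Ob \<T>"
    and T_weak_pullback:
      "weak_pullback \<T> P A B C p q f g \<Longrightarrow>
        weak_pullback \<T> (Tob \<T> P) (Tob \<T> A) (Tob \<T> B) (Tob \<T> C)
          (Tmap \<T> P A p) (Tmap \<T> P B q) (Tmap \<T> A C f) (Tmap \<T> B C g)"
    and mu_weak_pullback:
      "A \<in> Ob \<T> \<Longrightarrow> B \<in> Ob \<T> \<Longrightarrow> f \<in> A \<rightarrow> B \<Longrightarrow>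
        weak_pullback \<T> (Tob \<T> (Tob \<T> A)) (Tob \<T> A) (Tob \<T> (Tob \<T> B)) (Tob \<T> B)
          (mu \<T> A) (Tmap \<T> (Tob \<T> A) (Tob \<T> B) (Tmap \<T> A B f)) (Tmap \<T> A B f) (mu \<T> B)"
    and xi_eta: "xi \<T> (eta \<T> (Vset \<T>) (code \<T> v)) = v"
    and xi_mu:
      "t \<in> Tob \<T> (Tob \<T> (Vset \<T>)) \<Longrightarrow> xi_T \<T> (Tob \<T> (Vset \<T>)) (xi \<T>) t = xi \<T> (mu \<T> (Vset \<T>) t)"
    and xi_tensor:
      "t \<in> Tob \<T> (times \<T> (Vset \<T>) (Vset \<T>)) \<Longrightarrow>
        xi_T \<T> (times \<T> (Vset \<T>) (Vset \<T>))
          (\<lambda>w. tensor \<T> (decode \<T> (proj1 \<T> w)) (decode \<T> (proj2 \<T> w))) t =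
        tensor \<T> (xi \<T> (Tmap \<T> (times \<T> (Vset \<T>) (Vset \<T>)) (Vset \<T>) (proj1 \<T>) t))
          (xi \<T> (Tmap \<T> (times \<T> (Vset \<T>) (Vset \<T>)) (Vset \<T>) (proj2 \<T>) t))"
    and xi_kunit:
      "{c} \<in> Ob \<T> \<Longrightarrow> t \<in> Tob \<T> {c} \<Longrightarrow> xi_T \<T> {c} (\<lambda>_. kunit \<T>) t = kunit \<T>"
    and xi_pushforward:
      "X \<in> Ob \<T> \<Longrightarrow> Y \<in> Ob \<T> \<Longrightarrow> f \<in> X \<rightarrow> Y \<Longrightarrow> t \<in> Tob \<T> Y \<Longrightarrow>
        xi_T \<T> Y (pushforward X f \<phi>) t = pushforward (Tob \<T> X) (Tmap \<T> X Y f) (xi_T \<T> X \<phi>) t"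


section \<open>Relations\<close>

text \<open>
  A relation from \<open>X\<close> to \<open>Y\<close> with values in the quantale is a function \<open>'u \<Rightarrow> 'u \<Rightarrow> 'v\<close> of which
  only the values on \<open>X \<times> Y\<close> matter.
\<close>

type_synonym ('u, 'v) vrel = "'u \<Rightarrow> 'u \<Rightarrow> 'v"

definition rel_le :: "'u set \<Rightarrow> 'u set \<Rightarrow> ('u, 'v::order) vrel \<Rightarrow> ('u, 'v) vrel \<Rightarrow> bool" where
  "rel_le X Y r s \<longleftrightarrow> (\<forall>x\<in>X. \<forall>y\<in>Y. r x y \<le> s x y)"

definition rel_eq :: "'u set \<Rightarrow> 'u set \<Rightarrow> ('u, 'v) vrel \<Rightarrow> ('u, 'v) vrel \<Rightarrow> bool" where
  "rel_eq X Y r s \<longleftrightarrow> (\<forall>x\<in>X. \<forall>y\<in>Y. r x y = s x y)"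

text \<open>\<open>rel_comp \<T> Y s r\<close> is \<open>s \<cdot> r\<close>, for \<open>r\<close> into and \<open>s\<close> out of \<open>Y\<close>.\<close>

definition rel_comp ::
  "('u, 'v::complete_lattice, 'b) topological_theory_scheme \<Rightarrow> 'u set \<Rightarrow>
    ('u, 'v) vrel \<Rightarrow> ('u, 'v) vrel \<Rightarrow> ('u, 'v) vrel" where
  "rel_comp \<T> Y s r = (\<lambda>x z. SUP y\<in>Y. tensor \<T> (r x y) (s y z))"

definition rel_conv :: "('u, 'v) vrel \<Rightarrow> ('u, 'v) vrel" where
  "rel_conv r = (\<lambda>y x. r x y)"

definition map_rel ::
  "('u, 'v::complete_lattice, 'b) topological_theory_scheme \<Rightarrow> ('u \<Rightarrow> 'u) \<Rightarrow> ('u, 'v) vrel" where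
  "map_rel \<T> f = (\<lambda>x y. if f x = y then kunit \<T> else bot)"

definition T_xi ::
  "('u, 'v::complete_lattice, 'b) topological_theory_scheme \<Rightarrow> 'u set \<Rightarrow> 'u set \<Rightarrow>
    ('u, 'v) vrel \<Rightarrow> ('u, 'v) vrel" where
  "T_xi \<T> X Y r = (\<lambda>s t.
    SUP w\<in>{w \<in> Tob \<T> (times \<T> X Y).
            Tmap \<T> (times \<T> X Y) X (proj1 \<T>) w = s \<and> Tmap \<T> (times \<T> X Y) Y (proj2 \<T>) w = t}.
      xi_T \<T> (times \<T> X Y) (\<lambda>p. r (proj1 \<T> p) (proj2 \<T> p)) w)"


section \<open>Categories over a topological theory\<close>

definition T_graph ::
  "('u, 'v::complete_lattice, 'b) topological_theory_scheme \<Rightarrow> 'u set \<Rightarrow> ('u, 'v) vrel \<Rightarrow> bool" where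
  "T_graph \<T> X a \<longleftrightarrow> X \<in> Ob \<T> \<and> rel_le (Tob \<T> X) X (rel_conv (map_rel \<T> (eta \<T> X))) a"

definition T_category ::
  "('u, 'v::complete_lattice, 'b) topological_theory_scheme \<Rightarrow> 'u set \<Rightarrow> ('u, 'v) vrel \<Rightarrow> bool" where
  "T_category \<T> X a \<longleftrightarrow> T_graph \<T> X a \<and>
    rel_le (Tob \<T> X) X
      (rel_comp \<T> (Tob \<T> X) a
        (rel_comp \<T> (Tob \<T> (Tob \<T> X)) (T_xi \<T> (Tob \<T> X) X a) (rel_conv (map_rel \<T> (mu \<T> X)))))
      a"

definition T_functor ::
  "('u, 'v::complete_lattice, 'b) topological_theory_scheme \<Rightarrow>
    'u set \<Rightarrow> ('u, 'v) vrel \<Rightarrow> 'u set \<Rightarrow> ('u, 'v) vrel \<Rightarrow> ('u \<Rightarrow> 'u) \<Rightarrow> bool" where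
  "T_functor \<T> X a Y b f \<longleftrightarrow>
    f \<in> X \<rightarrow> Y \<and> (\<forall>t\<in>Tob \<T> X. \<forall>x\<in>X. a t x \<le> b (Tmap \<T> X Y f t) (f x))"

definition underlying ::
  "('u, 'v::complete_lattice, 'b) topological_theory_scheme \<Rightarrow> 'u set \<Rightarrow>
    ('u, 'v) vrel \<Rightarrow> ('u, 'v) vrel" where
  "underlying \<T> X a = rel_comp \<T> (Tob \<T> X) a (map_rel \<T> (eta \<T> X))"

text \<open>\<open>functor_le \<T> X Y b f g\<close> is \<open>f \<le> g\<close> for \<open>f, g : X \<rightarrow> (Y, b)\<close>.\<close>

definition functor_le ::
  "('u, 'v::complete_lattice, 'b) topological_theory_scheme \<Rightarrow> 'u set \<Rightarrow> 'u set \<Rightarrow>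
    ('u, 'v) vrel \<Rightarrow> ('u \<Rightarrow> 'u) \<Rightarrow> ('u \<Rightarrow> 'u) \<Rightarrow> bool" where
  "functor_le \<T> X Y b f g \<longleftrightarrow> (\<forall>x\<in>X. kunit \<T> \<le> underlying \<T> Y b (f x) (g x))"

text \<open>\<open>f : (X, a) \<rightarrow> (Y, b)\<close> is left adjoint to \<open>g : (Y, b) \<rightarrow> (X, a)\<close>.\<close>

definition left_adjoint ::
  "('u, 'v::complete_lattice, 'b) topological_theory_scheme \<Rightarrow>
    'u set \<Rightarrow> ('u, 'v) vrel \<Rightarrow> 'u set \<Rightarrow> ('u, 'v) vrel \<Rightarrow> ('u \<Rightarrow> 'u) \<Rightarrow> ('u \<Rightarrow> 'u) \<Rightarrow> bool" where
  "left_adjoint \<T> X a Y b f g \<longleftrightarrow>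
    T_functor \<T> X a Y b f \<and> T_functor \<T> Y b X a g \<and>
    functor_le \<T> X X a (\<lambda>x. x) (\<lambda>x. g (f x)) \<and> functor_le \<T> Y Y b (\<lambda>y. f (g y)) (\<lambda>y. y)"

definition core_compact ::
  "('u, 'v::complete_lattice, 'b) topological_theory_scheme \<Rightarrow> 'u set \<Rightarrow> ('u, 'v) vrel \<Rightarrow> bool" where
  "core_compact \<T> X a \<longleftrightarrow>
    rel_eq (Tob \<T> (Tob \<T> X)) X
      (rel_comp \<T> (Tob \<T> X) a (T_xi \<T> (Tob \<T> X) X a))
      (rel_comp \<T> (Tob \<T> X) a (map_rel \<T> (mu \<T> X)))"

text \<open>The structure \<open>T\<^sub>\<xi>a \<cdot> m\<^sup>\<circ> \<cdot> m\<close> on \<open>TX\<close>.\<close>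

definition T_struct ::
  "('u, 'v::complete_lattice, 'b) topological_theory_scheme \<Rightarrow> 'u set \<Rightarrow>
    ('u, 'v) vrel \<Rightarrow> ('u, 'v) vrel" where
  "T_struct \<T> X a =
    rel_comp \<T> (Tob \<T> (Tob \<T> X)) (T_xi \<T> (Tob \<T> X) X a)
      (rel_comp \<T> (Tob \<T> X) (rel_conv (map_rel \<T> (mu \<T> X))) (map_rel \<T> (mu \<T> X)))"

definition representable ::
  "('u, 'v::complete_lattice, 'b) topological_theory_scheme \<Rightarrow> 'u set \<Rightarrow> ('u, 'v) vrel \<Rightarrow> bool" where
  "representable \<T> X a \<longleftrightarrow>
    (\<exists>l. left_adjoint \<T> (Tob \<T> X) (T_struct \<T> X a) X a l (eta \<T> X))"

definition op_struct ::
  "('u, 'v::complete_lattice, 'b) topological_theory_scheme \<Rightarrow> 'u set \<Rightarrow>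
    ('u, 'v) vrel \<Rightarrow> ('u \<Rightarrow> 'u) \<Rightarrow> ('u, 'v) vrel" where
  "op_struct \<T> X a \<alpha> = rel_comp \<T> X (rel_conv (underlying \<T> X a)) (map_rel \<T> \<alpha>)"

end

theory Submission
  imports Defs
begin

text \<open>
  Write \<open>x \<le> y\<close> for \<open>k \<le> a\<^sub>0(x, y)\<close>; this is a preorder on \<open>X\<close>, as \<open>a\<^sub>0\<close> is reflexive and
  transitive, and \<open>a\<^sub>0\<close> is compatible with it in both variables. All three conditions turn out to
  say that \<open>\<alpha>\<close> is associative up to this preorder, that is, \<open>\<alpha> (T\<alpha> W) \<le> \<alpha> (m W)\<close> for all
  \<open>W \<in> TTX\<close>. The opposite inequality \<open>\<alpha> (m W) \<le> \<alpha> (T\<alpha> W)\<close> holds in every \<open>\<T>\<close>-category of the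
  form \<open>a = a\<^sub>0 \<cdot> \<alpha>\<close>, and so does \<open>\<alpha> (e x) \<simeq> x\<close>, where \<open>\<simeq>\<close> is equivalence in the preorder.

  The central fact is that \<open>\<alpha>\<close> is a functor \<open>(TX, T\<^sub>\<xi>a\<^sub>0) \<rightarrow> (X, a\<^sub>0)\<close> (lemma
  \<open>T_xi_underlying_le\<close>): this is transitivity of \<open>a\<close> at the elements \<open>Te(s)\<close> of \<open>TTX\<close>. It gives
  \<open>T\<^sub>\<xi>a(W, t) \<le> a\<^sub>0(\<alpha> (T\<alpha> W), \<alpha> t)\<close>, with value at least \<open>k\<close> on the left for \<open>t = T\<alpha> W\<close>, so that
  \<open>a \<cdot> T\<^sub>\<xi>a\<close> sends \<open>W\<close> to \<open>a\<^sub>0(\<alpha> (T\<alpha> W), _)\<close>, whereas \<open>a \<cdot> m\<close> sends it to \<open>a\<^sub>0(\<alpha> (m W), _)\<close>.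
  Hence core-compactness is associativity. Dually, the structure of \<open>X\<^sup>o\<^sup>p\<close> is transitive iff
  \<open>a\<^sub>0(_, \<alpha> (T\<alpha> W)) \<le> a\<^sub>0(_, \<alpha> (m W))\<close>, which is associativity again.

  For representability, \<open>a_hat\<close> denotes the structure of \<open>TX\<close>. One has \<open>a_hat\<^sub>0(t, e x) = a(t, x)\<close>, so
  a left adjoint of \<open>e\<close> represents \<open>a\<close>, and is therefore equivalent to \<open>\<alpha>\<close>. Since
  \<open>k \<le> a_hat(W, m W)\<close>, its being a \<open>\<T>\<close>-functor forces associativity; conversely associativity makes
  \<open>\<alpha>\<close> itself a \<open>\<T>\<close>-functor.

  The inequalities about the extension \<open>T\<^sub>\<xi>\<close> all come from one fact: its values bound those
  obtained from arbitrary spans (lemma \<open>xi_T_le_T_xi\<close>), which rests on the monotonicity of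
  \<open>\<phi> \<mapsto> \<xi> \<cdot> T\<phi>\<close>.
\<close>

section \<open>The extension of the monad to relations\<close>

context set_category
begin

lemma proj_pair [simp]: "proj1 S (pair S (x, y)) = x" "proj2 S (pair S (x, y)) = y"
  by (simp_all add: proj1_def proj2_def inj_pair)

lemma pair_in_times [intro]: "x \<in> A \<Longrightarrow> y \<in> B \<Longrightarrow> pair S (x, y) \<in> times S A B"
  by (auto simp: times_def)

lemma proj1_in: "w \<in> times S A B \<Longrightarrow> proj1 S w \<in> A"
  and proj2_in: "w \<in> times S A B \<Longrightarrow> proj2 S w \<in> B"
  by (auto simp: times_def)

end

context topological_theory
begin

lemma tensor_bot [simp]: "tensor \<T> u bot = bot" "tensor \<T> bot u = bot"
  using tensor_Sup[of u "{}"] by (simp_all add: commute[of bot])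

lemma tensor_mono:
  assumes "u \<le> u'" "v \<le> v'"
  shows "tensor \<T> u v \<le> tensor \<T> u' v'"
proof -
  have right: "tensor \<T> x y \<le> tensor \<T> x y'" if "y \<le> y'" for x y y'
    using tensor_Sup[of x "{y, y'}"] that by (simp add: sup_absorb2 le_iff_sup)
  show ?thesis
    using right[OF assms(2), of u] right[OF assms(1), of v'] by (simp add: commute order_trans)
qed

lemma kunit_tensor_le:
  assumes "kunit \<T> \<le> u"
  shows "v \<le> tensor \<T> u v" "v \<le> tensor \<T> v u"
  using tensor_mono[OF assms order_refl, of v] by (simp_all add: commute)

lemma rel_comp_map_rel:
  assumes "f x \<in> Y"
  shows "rel_comp \<T> Y s (map_rel \<T> f) x z = s (f x) z"
  unfolding rel_comp_def map_rel_def
proof (rule antisym)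
  show "(SUP y\<in>Y. tensor \<T> (if f x = y then kunit \<T> else bot) (s y z)) \<le> s (f x) z"
    by (rule SUP_least) auto
  show "s (f x) z \<le> (SUP y\<in>Y. tensor \<T> (if f x = y then kunit \<T> else bot) (s y z))"
    using assms by (intro SUP_upper2[of "f x"]) auto
qed

lemma rel_comp_conv_map_rel:
  "rel_comp \<T> Y s (rel_conv (map_rel \<T> f)) x z = (SUP y\<in>{y \<in> Y. f y = x}. s y z)"
  unfolding rel_comp_def map_rel_def rel_conv_def
proof (rule antisym)
  show "(SUP y\<in>Y. tensor \<T> (if f y = x then kunit \<T> else bot) (s y z))
      \<le> (SUP y\<in>{y \<in> Y. f y = x}. s y z)"
    by (rule SUP_least) (auto intro: SUP_upper)
  show "(SUP y\<in>{y \<in> Y. f y = x}. s y z)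
      \<le> (SUP y\<in>Y. tensor \<T> (if f y = x then kunit \<T> else bot) (s y z))"
  proof (rule SUP_least)
    fix y assume "y \<in> {y \<in> Y. f y = x}"
    then show "s y z \<le> (SUP y\<in>Y. tensor \<T> (if f y = x then kunit \<T> else bot) (s y z))"
      by (intro SUP_upper2[of y]) auto
  qed
qed

lemma code_in_Vset [simp]: "code \<T> v \<in> Vset \<T>"
  by (simp add: Vset_def)

lemma decode_code [simp]: "decode \<T> (code \<T> v) = v"
  by (simp add: decode_def inj_code)

lemma xi_T_cong:
  assumes "X \<in> Ob \<T>" "t \<in> Tob \<T> X" "\<And>x. x \<in> X \<Longrightarrow> \<phi> x = \<psi> x"
  shows "xi_T \<T> X \<phi> t = xi_T \<T> X \<psi> t"
  unfolding xi_T_def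
  by (rule arg_cong[of _ _ "xi \<T>"], rule Tmap_cong) (auto simp: assms Vset_Ob)

lemma xi_T_Tmap:
  assumes "X \<in> Ob \<T>" "Y \<in> Ob \<T>" "f \<in> X \<rightarrow> Y" "t \<in> Tob \<T> X"
  shows "xi_T \<T> Y \<phi> (Tmap \<T> X Y f t) = xi_T \<T> X (\<lambda>x. \<phi> (f x)) t"
  unfolding xi_T_def
  using Tmap_comp[OF assms(1,2) Vset_Ob assms(3) _ assms(4), of "\<lambda>x. code \<T> (\<phi> x)"] by simp

lemma xi_T_eta:
  assumes "X \<in> Ob \<T>" "x \<in> X"
  shows "xi_T \<T> X \<phi> (eta \<T> X x) = \<phi> x"
  unfolding xi_T_def
  using eta_natural[OF assms(1) Vset_Ob _ assms(2), of "\<lambda>x. code \<T> (\<phi> x)"]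
  by (simp add: xi_eta)

lemma xi_T_kunit:
  assumes "X \<in> Ob \<T>" "t \<in> Tob \<T> X"
  shows "xi_T \<T> X (\<lambda>_. kunit \<T>) t = kunit \<T>"
proof -
  let ?c = "code \<T> (kunit \<T>)"
  have c: "{?c} \<in> Ob \<T>"
    by (rule subset_closed[OF Vset_Ob]) simp
  have const: "(\<lambda>_. ?c) \<in> X \<rightarrow> {?c}"
    by simp
  show ?thesis
    using xi_T_Tmap[OF assms(1) c const assms(2), of "\<lambda>_. kunit \<T>"]
      xi_kunit[OF c funcset_mem[OF Tmap_closed[OF assms(1) c const] assms(2)]] by simp
qed

text \<open>
  Compatibility of \<open>\<xi>\<close> with \<open>f\<^sub>!\<close> contains monotonicity: \<open>\<psi>\<close> is the pushforward of the second
  projection along the first projection of its hypograph \<open>{(x, v). v \<le> \<psi> x}\<close>, and every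
  \<open>\<phi> \<le> \<psi>\<close> is a section of that hypograph.
\<close>

lemma xi_T_mono:
  assumes X: "X \<in> Ob \<T>" and t: "t \<in> Tob \<T> X" and le: "\<And>x. x \<in> X \<Longrightarrow> \<phi> x \<le> \<psi> x"
  shows "xi_T \<T> X \<phi> t \<le> xi_T \<T> X \<psi> t"
proof -
  define H where "H = {pair \<T> (x, code \<T> v) | x v. x \<in> X \<and> v \<le> \<psi> x}"
  define \<Phi> where "\<Phi> w = decode \<T> (proj2 \<T> w)" for w
  define s where "s x = pair \<T> (x, code \<T> (\<phi> x))" for x
  have H: "H \<in> Ob \<T>"
    by (rule subset_closed[OF times_closed[OF X Vset_Ob]]) (auto simp: H_def)
  have p: "proj1 \<T> \<in> H \<rightarrow> X"
    by (auto simp: H_def)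
  have s: "s \<in> X \<rightarrow> H"
    unfolding H_def s_def using le by blast
  have push: "pushforward H (proj1 \<T>) \<Phi> x = \<psi> x" if "x \<in> X" for x
    unfolding pushforward_def
  proof (rule antisym)
    show "(SUP w\<in>{w \<in> H. proj1 \<T> w = x}. \<Phi> w) \<le> \<psi> x"
      by (rule SUP_least) (auto simp: H_def \<Phi>_def)
    show "\<psi> x \<le> (SUP w\<in>{w \<in> H. proj1 \<T> w = x}. \<Phi> w)"
      using that by (intro SUP_upper2[of "pair \<T> (x, code \<T> (\<psi> x))"]) (auto simp: H_def \<Phi>_def)
  qed
  have "Tmap \<T> H X (proj1 \<T>) (Tmap \<T> X H s t) = t"
    using Tmap_comp[OF X H X s p t] Tmap_id[OF X t] by (simp add: s_def)
  moreover have "Tmap \<T> X H s t \<in> Tob \<T> H"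
    using Tmap_closed[OF X H s] t by blast
  ultimately have "xi_T \<T> H \<Phi> (Tmap \<T> X H s t)
      \<le> pushforward (Tob \<T> H) (Tmap \<T> H X (proj1 \<T>)) (xi_T \<T> H \<Phi>) t"
    unfolding pushforward_def by (intro SUP_upper) simp
  also have "\<dots> = xi_T \<T> X \<psi> t"
    using xi_pushforward[OF H X p t, of \<Phi>] xi_T_cong[OF X t push] by simp
  finally show ?thesis
    by (simp add: xi_T_Tmap[OF X H s t] \<Phi>_def s_def)
qed

text \<open>
  The definition of \<open>T\<^sub>\<xi>\<close> only tests the span of projections; its value in fact bounds the one
  obtained from any span \<open>X \<leftarrow> Q \<rightarrow> Y\<close>, since the span factors through \<open>X \<times> Y\<close>.
\<close>

lemma xi_T_le_T_xi:
  assumes ob: "Q \<in> Ob \<T>" "X \<in> Ob \<T>" "Y \<in> Ob \<T>"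
    and f: "f \<in> Q \<rightarrow> X" and g: "g \<in> Q \<rightarrow> Y" and w: "w \<in> Tob \<T> Q"
    and le: "\<And>q. q \<in> Q \<Longrightarrow> \<phi> q \<le> r (f q) (g q)"
  shows "xi_T \<T> Q \<phi> w \<le> T_xi \<T> X Y r (Tmap \<T> Q X f w) (Tmap \<T> Q Y g w)"
proof -
  define h where "h q = pair \<T> (f q, g q)" for q
  let ?P = "times \<T> X Y"
  have P: "?P \<in> Ob \<T>" using ob by (simp add: times_closed)
  have h: "h \<in> Q \<rightarrow> ?P" using f g by (auto simp: h_def Pi_iff)
  have p: "proj1 \<T> \<in> ?P \<rightarrow> X" "proj2 \<T> \<in> ?P \<rightarrow> Y" by (auto intro: proj1_in proj2_in)
  have proj: "Tmap \<T> ?P X (proj1 \<T>) (Tmap \<T> Q ?P h w) = Tmap \<T> Q X f w"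
    "Tmap \<T> ?P Y (proj2 \<T>) (Tmap \<T> Q ?P h w) = Tmap \<T> Q Y g w"
    using Tmap_comp[OF ob(1) P ob(2) h p(1) w] Tmap_comp[OF ob(1) P ob(3) h p(2) w]
    by (simp_all add: h_def)
  have "xi_T \<T> Q \<phi> w \<le> xi_T \<T> Q (\<lambda>q. r (f q) (g q)) w"
    using ob(1) w le by (rule xi_T_mono)
  also have "\<dots> = xi_T \<T> ?P (\<lambda>p. r (proj1 \<T> p) (proj2 \<T> p)) (Tmap \<T> Q ?P h w)"
    by (simp add: xi_T_Tmap[OF ob(1) P h w] h_def)
  also have "\<dots> \<le> T_xi \<T> X Y r (Tmap \<T> Q X f w) (Tmap \<T> Q Y g w)"
    unfolding T_xi_def using proj funcset_mem[OF Tmap_closed[OF ob(1) P h] w]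
    by (intro SUP_upper) simp
  finally show ?thesis .
qed

lemma T_xi_leI:
  assumes "\<And>w. w \<in> Tob \<T> (times \<T> X Y) \<Longrightarrow> Tmap \<T> (times \<T> X Y) X (proj1 \<T>) w = s \<Longrightarrow>
      Tmap \<T> (times \<T> X Y) Y (proj2 \<T>) w = t \<Longrightarrow>
      xi_T \<T> (times \<T> X Y) (\<lambda>p. r (proj1 \<T> p) (proj2 \<T> p)) w \<le> v"
  shows "T_xi \<T> X Y r s t \<le> v"
  unfolding T_xi_def using assms by (auto intro: SUP_least)

lemma kunit_le_T_xi:
  assumes "Q \<in> Ob \<T>" "X \<in> Ob \<T>" "Y \<in> Ob \<T>" "f \<in> Q \<rightarrow> X" "g \<in> Q \<rightarrow> Y" "w \<in> Tob \<T> Q"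
    and "\<And>q. q \<in> Q \<Longrightarrow> kunit \<T> \<le> r (f q) (g q)"
  shows "kunit \<T> \<le> T_xi \<T> X Y r (Tmap \<T> Q X f w) (Tmap \<T> Q Y g w)"
  using xi_T_le_T_xi[OF assms(1-6), of "\<lambda>_. kunit \<T>" r] assms(7) xi_T_kunit[OF assms(1,6)] by simp

text \<open>
  In other words, \<open>T\<^sub>\<xi>(r' \<cdot> f) \<le> T\<^sub>\<xi>r' \<cdot> Tf\<close>: an element of \<open>T(X \<times> Y)\<close> over \<open>(s, t)\<close> gives one
  over \<open>(Tf(s), t)\<close> when the first leg of the span of projections is followed by \<open>f\<close>.
\<close>

lemma T_xi_le_T_xi_Tmap:
  assumes ob: "X \<in> Ob \<T>" "Y \<in> Ob \<T>" "X' \<in> Ob \<T>"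
    and f: "f \<in> X \<rightarrow> X'"
    and le: "\<And>x y. x \<in> X \<Longrightarrow> y \<in> Y \<Longrightarrow> r x y \<le> r' (f x) y"
  shows "T_xi \<T> X Y r s t \<le> T_xi \<T> X' Y r' (Tmap \<T> X X' f s) t"
proof (rule T_xi_leI)
  let ?P = "times \<T> X Y"
  fix w
  assume w: "w \<in> Tob \<T> ?P" "Tmap \<T> ?P X (proj1 \<T>) w = s" "Tmap \<T> ?P Y (proj2 \<T>) w = t"
  have P: "?P \<in> Ob \<T>" using ob by (simp add: times_closed)
  have p: "proj1 \<T> \<in> ?P \<rightarrow> X" "proj2 \<T> \<in> ?P \<rightarrow> Y" by (auto intro: proj1_in proj2_in)
  have fp: "(\<lambda>q. f (proj1 \<T> q)) \<in> ?P \<rightarrow> X'" using f p by auto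
  show "xi_T \<T> ?P (\<lambda>p. r (proj1 \<T> p) (proj2 \<T> p)) w \<le> T_xi \<T> X' Y r' (Tmap \<T> X X' f s) t"
    using xi_T_le_T_xi[OF P ob(3,2) fp p(2) w(1), of "\<lambda>p. r (proj1 \<T> p) (proj2 \<T> p)" r']
      Tmap_comp[OF P ob(1,3) p(1) f w(1)] w le[OF proj1_in proj2_in] by simp
qed

lemma T_xi_le_T_xi_conv:
  assumes ob: "X \<in> Ob \<T>" "Y \<in> Ob \<T>"
  shows "T_xi \<T> X Y r s t \<le> T_xi \<T> Y X (rel_conv r) t s"
proof (rule T_xi_leI)
  let ?P = "times \<T> X Y"
  fix w
  assume w: "w \<in> Tob \<T> ?P" "Tmap \<T> ?P X (proj1 \<T>) w = s" "Tmap \<T> ?P Y (proj2 \<T>) w = t"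
  have P: "?P \<in> Ob \<T>" using ob by (simp add: times_closed)
  have p: "proj1 \<T> \<in> ?P \<rightarrow> X" "proj2 \<T> \<in> ?P \<rightarrow> Y" by (auto intro: proj1_in proj2_in)
  show "xi_T \<T> ?P (\<lambda>p. r (proj1 \<T> p) (proj2 \<T> p)) w \<le> T_xi \<T> Y X (rel_conv r) t s"
    using xi_T_le_T_xi[OF P ob(2,1) p(2,1) w(1), of "\<lambda>p. r (proj1 \<T> p) (proj2 \<T> p)" "rel_conv r"] w
    by (simp add: rel_conv_def)
qed

lemma le_T_xi_eta:
  assumes ob: "X \<in> Ob \<T>" "Y \<in> Ob \<T>" and mem: "x \<in> X" "y \<in> Y"
  shows "r x y \<le> T_xi \<T> X Y r (eta \<T> X x) (eta \<T> Y y)"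
proof -
  let ?P = "times \<T> X Y"
  have P: "?P \<in> Ob \<T>" using ob by (simp add: times_closed)
  have xy: "pair \<T> (x, y) \<in> ?P" using mem by blast
  have p: "proj1 \<T> \<in> ?P \<rightarrow> X" "proj2 \<T> \<in> ?P \<rightarrow> Y" by (auto intro: proj1_in proj2_in)
  show ?thesis
    using xi_T_le_T_xi[OF P ob p funcset_mem[OF eta_closed[OF P] xy],
        of "\<lambda>p. r (proj1 \<T> p) (proj2 \<T> p)" r]
    by (simp add: xi_T_eta[OF P xy] eta_natural[OF P _ _ xy] ob p)
qed

section \<open>Categories and their underlying order\<close>

lemma T_graph_iff:
  "T_graph \<T> X a \<longleftrightarrow> X \<in> Ob \<T> \<and> (\<forall>x\<in>X. kunit \<T> \<le> a (eta \<T> X x) x)"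
  using eta_closed[of X] by (auto simp: T_graph_def rel_le_def rel_conv_def map_rel_def)

lemma T_category_iff:
  "T_category \<T> X a \<longleftrightarrow> T_graph \<T> X a \<and>
    (\<forall>W\<in>Tob \<T> (Tob \<T> X). \<forall>t\<in>Tob \<T> X. \<forall>x\<in>X.
      tensor \<T> (T_xi \<T> (Tob \<T> X) X a W t) (a t x) \<le> a (mu \<T> X W) x)"
  (is "_ \<longleftrightarrow> _ \<and> ?trans")
proof -
  have "?trans \<longleftrightarrow> rel_le (Tob \<T> X) X
      (rel_comp \<T> (Tob \<T> X) a
        (rel_comp \<T> (Tob \<T> (Tob \<T> X)) (T_xi \<T> (Tob \<T> X) X a) (rel_conv (map_rel \<T> (mu \<T> X))))) a"
    if X: "X \<in> Ob \<T>"
  proof -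
    have sup: "tensor \<T> (SUP W\<in>{W \<in> A. mu \<T> X W = s}. F W) v \<le> u
        \<longleftrightarrow> (\<forall>W\<in>A. mu \<T> X W = s \<longrightarrow> tensor \<T> (F W) v \<le> u)" for A s u v F
      by (simp add: commute[of _ v] tensor_Sup SUP_le_iff image_image) blast
    show ?thesis
      using funcset_mem[OF mu_closed[OF X]]
      by (auto simp: rel_le_def rel_comp_def[of \<T> "Tob \<T> X"] rel_comp_conv_map_rel SUP_le_iff sup)
  qed
  then show ?thesis
    by (auto simp: T_category_def T_graph_def)
qed

lemma T_struct_eq:
  assumes "X \<in> Ob \<T>" "W \<in> Tob \<T> (Tob \<T> X)"
  shows "T_struct \<T> X a W t
    = (SUP W'\<in>{W' \<in> Tob \<T> (Tob \<T> X). mu \<T> X W' = mu \<T> X W}. T_xi \<T> (Tob \<T> X) X a W' t)"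
proof -
  have "mu \<T> X W \<in> Tob \<T> X" using mu_closed assms by blast
  then show ?thesis
    unfolding T_struct_def rel_comp_conv_map_rel[symmetric]
    by (simp add: rel_comp_def[of \<T> "Tob \<T> (Tob \<T> X)"] rel_comp_map_rel)
qed

end

locale represented_category = topological_theory \<T>
  for \<T> :: "('u, 'v::complete_lattice, 'b) topological_theory_scheme" +
  fixes X :: "'u set" and a :: "('u, 'v) vrel" and \<alpha> :: "'u \<Rightarrow> 'u"
  assumes category: "T_category \<T> X a"
    and alpha_closed: "\<alpha> \<in> Tob \<T> X \<rightarrow> X"
    and represented: "rel_eq (Tob \<T> X) X a (rel_comp \<T> X (underlying \<T> X a) (map_rel \<T> \<alpha>))"
begin

abbreviation k where "k \<equiv> kunit \<T>"
abbreviation e where "e \<equiv> eta \<T> X"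
abbreviation m where "m \<equiv> mu \<T> X"
abbreviation TX where "TX \<equiv> Tob \<T> X"
abbreviation TTX where "TTX \<equiv> Tob \<T> (Tob \<T> X)"
abbreviation T\<alpha> where "T\<alpha> \<equiv> Tmap \<T> TX X \<alpha>"
abbreviation a\<^sub>0 where "a\<^sub>0 \<equiv> underlying \<T> X a"
abbreviation Ta where "Ta \<equiv> T_xi \<T> TX X a"

lemma X: "X \<in> Ob \<T>" and TX: "TX \<in> Ob \<T>"
  using category by (auto simp: T_category_def T_graph_def Tob_closed)

lemma mem [simp]:
  "x \<in> X \<Longrightarrow> e x \<in> TX" "t \<in> TX \<Longrightarrow> \<alpha> t \<in> X" "W \<in> TTX \<Longrightarrow> m W \<in> TX" "W \<in> TTX \<Longrightarrow> T\<alpha> W \<in> TX"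
  "t \<in> TX \<Longrightarrow> Tmap \<T> X TX e t \<in> TTX" "t \<in> TX \<Longrightarrow> eta \<T> TX t \<in> TTX"
  using eta_closed[OF X] eta_closed[OF TX] mu_closed[OF X] alpha_closed
    Tmap_closed[OF TX X alpha_closed] Tmap_closed[OF X TX eta_closed[OF X]]
  by blast+

lemma underlying_eq: "x \<in> X \<Longrightarrow> a\<^sub>0 x y = a (e x) y"
  by (simp add: underlying_def rel_comp_map_rel)

lemma a_eq: "t \<in> TX \<Longrightarrow> x \<in> X \<Longrightarrow> a t x = a\<^sub>0 (\<alpha> t) x"
  using represented by (simp add: rel_eq_def rel_comp_map_rel)

lemma a_trans:
  "W \<in> TTX \<Longrightarrow> t \<in> TX \<Longrightarrow> x \<in> X \<Longrightarrow> tensor \<T> (Ta W t) (a t x) \<le> a (m W) x"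
  using category by (simp add: T_category_iff)

lemma underlying_refl: "x \<in> X \<Longrightarrow> k \<le> a\<^sub>0 x x"
  using category by (simp add: T_category_iff T_graph_iff underlying_eq)

lemma a_alpha: "t \<in> TX \<Longrightarrow> k \<le> a t (\<alpha> t)"
  by (simp add: a_eq underlying_refl)

lemma underlying_trans:
  assumes "x \<in> X" "y \<in> X" "z \<in> X"
  shows "tensor \<T> (a\<^sub>0 x y) (a\<^sub>0 y z) \<le> a\<^sub>0 x z"
proof -
  have "tensor \<T> (a\<^sub>0 x y) (a\<^sub>0 y z) \<le> tensor \<T> (Ta (eta \<T> TX (e x)) (e y)) (a (e y) z)"
    using assms le_T_xi_eta[OF TX X, of "e x" y a] by (intro tensor_mono) (auto simp: underlying_eq)
  also have "\<dots> \<le> a (m (eta \<T> TX (e x))) z"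
    using assms by (intro a_trans) auto
  also have "\<dots> = a\<^sub>0 x z"
    using assms by (simp add: mu_eta X underlying_eq)
  finally show ?thesis .
qed

lemma underlying_mono:
  assumes "k \<le> a\<^sub>0 y z" "x \<in> X" "y \<in> X" "z \<in> X"
  shows "a\<^sub>0 x y \<le> a\<^sub>0 x z"
  using kunit_tensor_le(2)[OF assms(1)] underlying_trans assms(2-) order_trans by blast

lemma underlying_antimono:
  assumes "k \<le> a\<^sub>0 x y" "x \<in> X" "y \<in> X" "z \<in> X"
  shows "a\<^sub>0 y z \<le> a\<^sub>0 x z"
  using kunit_tensor_le(1)[OF assms(1)] underlying_trans assms(2-) order_trans by blast

lemma alpha_eta:
  assumes "x \<in> X"
  shows "k \<le> a\<^sub>0 (\<alpha> (e x)) x" "k \<le> a\<^sub>0 x (\<alpha> (e x))"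
proof -
  show "k \<le> a\<^sub>0 (\<alpha> (e x)) x"
    using underlying_refl[OF assms] a_eq[of "e x" x] assms underlying_eq[of x x] by simp
  show "k \<le> a\<^sub>0 x (\<alpha> (e x))"
    using a_alpha[of "e x"] assms by (simp add: underlying_eq)
qed

text \<open>
  \<open>T\<^sub>\<xi>a\<^sub>0(s, t)\<close> is at most \<open>T\<^sub>\<xi>a(Te(s), t)\<close>, and \<open>m (Te(s)) = s\<close>, so transitivity of \<open>a\<close> bounds it
  by \<open>a(s, \<alpha> t)\<close>.
\<close>

lemma T_xi_underlying_le:
  assumes "s \<in> TX" "t \<in> TX"
  shows "T_xi \<T> X X a\<^sub>0 s t \<le> a\<^sub>0 (\<alpha> s) (\<alpha> t)"
proof -
  have "T_xi \<T> X X a\<^sub>0 s t \<le> Ta (Tmap \<T> X TX e s) t"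
    by (rule T_xi_le_T_xi_Tmap[OF X X TX eta_closed[OF X]]) (simp add: underlying_eq)
  also have "\<dots> \<le> tensor \<T> (Ta (Tmap \<T> X TX e s) t) (a t (\<alpha> t))"
    using assms by (intro kunit_tensor_le a_alpha)
  also have "\<dots> \<le> a (m (Tmap \<T> X TX e s)) (\<alpha> t)"
    using assms by (intro a_trans) auto
  also have "\<dots> = a\<^sub>0 (\<alpha> s) (\<alpha> t)"
    using assms by (simp add: mu_Tmap_eta X a_eq)
  finally show ?thesis .
qed

lemma Ta_le:
  assumes "W \<in> TTX" "t \<in> TX"
  shows "Ta W t \<le> a\<^sub>0 (\<alpha> (T\<alpha> W)) (\<alpha> t)"
proof -
  have "Ta W t \<le> T_xi \<T> X X a\<^sub>0 (T\<alpha> W) t"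
    by (rule T_xi_le_T_xi_Tmap[OF TX X X alpha_closed]) (simp add: a_eq)
  then show ?thesis
    using T_xi_underlying_le[of "T\<alpha> W" t] assms by simp
qed

lemma Ta_T_alpha: "W \<in> TTX \<Longrightarrow> k \<le> Ta W (T\<alpha> W)"
  using kunit_le_T_xi[OF TX TX X _ alpha_closed, of "\<lambda>x. x" W a] a_alpha by (simp add: Tmap_id TX)

text \<open>Transitivity of \<open>a\<close> along \<open>W\<close>, \<open>T\<alpha> W\<close>, \<open>\<alpha> (T\<alpha> W)\<close>, both steps having value at least \<open>k\<close>.\<close>

lemma alpha_mu_le: "W \<in> TTX \<Longrightarrow> k \<le> a\<^sub>0 (\<alpha> (m W)) (\<alpha> (T\<alpha> W))"
  using a_trans[of W "T\<alpha> W" "\<alpha> (T\<alpha> W)"] kunit_tensor_le(2)[OF a_alpha, of "T\<alpha> W"]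
    Ta_T_alpha[of W] by (simp add: a_eq) (meson order_trans)

section \<open>Associativity of the representing map\<close>

definition associative where
  "associative \<longleftrightarrow> (\<forall>W\<in>TTX. k \<le> a\<^sub>0 (\<alpha> (T\<alpha> W)) (\<alpha> (m W)))"

text \<open>
  In \<open>X\<^sup>o\<^sup>p\<close> the tuple \<open>W\<close>, \<open>T\<alpha> W\<close>, \<open>\<alpha> (T\<alpha> W)\<close> is again a pair of steps with value at least
  \<open>k\<close>, but its composite now reads \<open>\<alpha> (T\<alpha> W) \<le> \<alpha> (m W)\<close>. Conversely, up to conversion the
  extended structure is below \<open>T\<^sub>\<xi>a\<^sub>0\<close>, on which \<open>\<alpha>\<close> is functorial.
\<close>

lemma T_category_op_iff: "T_category \<T> X (op_struct \<T> X a \<alpha>) \<longleftrightarrow> associative"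
proof -
  let ?c = "op_struct \<T> X a \<alpha>"
  have c: "?c t x = a\<^sub>0 x (\<alpha> t)" if "t \<in> TX" for t x
    using that by (simp add: op_struct_def rel_comp_map_rel rel_conv_def)
  have graph: "T_graph \<T> X ?c"
    by (simp add: T_graph_iff X c alpha_eta)
  have upper: "T_xi \<T> TX X ?c W t \<le> a\<^sub>0 (\<alpha> t) (\<alpha> (T\<alpha> W))" if "W \<in> TTX" "t \<in> TX" for W t
  proof -
    have "T_xi \<T> TX X ?c W t \<le> T_xi \<T> X X (rel_conv a\<^sub>0) (T\<alpha> W) t"
      by (rule T_xi_le_T_xi_Tmap[OF TX X X alpha_closed]) (simp add: c rel_conv_def)
    also have "\<dots> \<le> T_xi \<T> X X a\<^sub>0 t (T\<alpha> W)"
      using T_xi_le_T_xi_conv[OF X X, of "rel_conv a\<^sub>0"] by (simp add: rel_conv_def)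
    also have "\<dots> \<le> a\<^sub>0 (\<alpha> t) (\<alpha> (T\<alpha> W))"
      using that by (simp add: T_xi_underlying_le)
    finally show ?thesis .
  qed
  show ?thesis
  proof
    assume cat: "T_category \<T> X ?c"
    show associative
      unfolding associative_def
    proof
      fix W assume W: "W \<in> TTX"
      have "k \<le> T_xi \<T> TX X ?c W (T\<alpha> W)"
        using kunit_le_T_xi[OF TX TX X _ alpha_closed W, of "\<lambda>x. x" ?c]
        by (simp add: Tmap_id TX W c underlying_refl)
      then have "k \<le> tensor \<T> (T_xi \<T> TX X ?c W (T\<alpha> W)) (?c (T\<alpha> W) (\<alpha> (T\<alpha> W)))"
        using kunit_tensor_le(2)[OF underlying_refl, of "\<alpha> (T\<alpha> W)"] W
        by (simp add: c) (meson order_trans)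
      also have "\<dots> \<le> ?c (m W) (\<alpha> (T\<alpha> W))"
        using cat W by (simp add: T_category_iff)
      finally show "k \<le> a\<^sub>0 (\<alpha> (T\<alpha> W)) (\<alpha> (m W))"
        using W by (simp add: c)
    qed
  next
    assume assoc: associative
    have "tensor \<T> (T_xi \<T> TX X ?c W t) (?c t x) \<le> ?c (m W) x"
      if "W \<in> TTX" "t \<in> TX" "x \<in> X" for W t x
    proof -
      have "tensor \<T> (T_xi \<T> TX X ?c W t) (?c t x)
          \<le> tensor \<T> (a\<^sub>0 x (\<alpha> t)) (a\<^sub>0 (\<alpha> t) (\<alpha> (T\<alpha> W)))"
        using that upper by (simp add: c commute[of _ "a\<^sub>0 x (\<alpha> t)"] tensor_mono)
      also have "\<dots> \<le> a\<^sub>0 x (\<alpha> (T\<alpha> W))"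
        using that by (simp add: underlying_trans)
      also have "\<dots> \<le> a\<^sub>0 x (\<alpha> (m W))"
        using that assoc by (intro underlying_mono) (auto simp: associative_def)
      finally show ?thesis
        using that by (simp add: c)
    qed
    then show "T_category \<T> X ?c"
      using graph by (simp add: T_category_iff)
  qed
qed

lemma core_compact_iff: "core_compact \<T> X a \<longleftrightarrow> associative"
proof -
  have comp: "rel_comp \<T> TX a Ta W x = a\<^sub>0 (\<alpha> (T\<alpha> W)) x" if W: "W \<in> TTX" and x: "x \<in> X" for W x
    unfolding rel_comp_def
  proof (rule antisym)
    show "(SUP t\<in>TX. tensor \<T> (Ta W t) (a t x)) \<le> a\<^sub>0 (\<alpha> (T\<alpha> W)) x"
    proof (rule SUP_least)
      fix t assume t: "t \<in> TX"
      have "tensor \<T> (Ta W t) (a t x) \<le> tensor \<T> (a\<^sub>0 (\<alpha> (T\<alpha> W)) (\<alpha> t)) (a\<^sub>0 (\<alpha> t) x)"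
        using W x t by (intro tensor_mono Ta_le) (auto simp: a_eq)
      also have "\<dots> \<le> a\<^sub>0 (\<alpha> (T\<alpha> W)) x"
        using W x t by (intro underlying_trans) auto
      finally show "tensor \<T> (Ta W t) (a t x) \<le> a\<^sub>0 (\<alpha> (T\<alpha> W)) x" .
    qed
    show "a\<^sub>0 (\<alpha> (T\<alpha> W)) x \<le> (SUP t\<in>TX. tensor \<T> (Ta W t) (a t x))"
      using W x kunit_tensor_le(1)[OF Ta_T_alpha[OF W]]
      by (intro SUP_upper2[of "T\<alpha> W"]) (auto simp: a_eq)
  qed
  have "core_compact \<T> X a \<longleftrightarrow> (\<forall>W\<in>TTX. \<forall>x\<in>X. a\<^sub>0 (\<alpha> (T\<alpha> W)) x = a\<^sub>0 (\<alpha> (m W)) x)"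
    by (simp add: core_compact_def rel_eq_def comp rel_comp_map_rel a_eq)
  also have "\<dots> \<longleftrightarrow> associative"
  proof
    assume "\<forall>W\<in>TTX. \<forall>x\<in>X. a\<^sub>0 (\<alpha> (T\<alpha> W)) x = a\<^sub>0 (\<alpha> (m W)) x"
    then show associative
      by (simp add: associative_def underlying_refl)
  next
    assume associative
    then show "\<forall>W\<in>TTX. \<forall>x\<in>X. a\<^sub>0 (\<alpha> (T\<alpha> W)) x = a\<^sub>0 (\<alpha> (m W)) x"
      using alpha_mu_le by (auto simp: associative_def intro!: antisym underlying_antimono)
  qed
  finally show ?thesis .
qed

section \<open>Representability\<close>

abbreviation a_hat where "a_hat \<equiv> T_struct \<T> X a"

lemma a_hat_cong: "W \<in> TTX \<Longrightarrow> W' \<in> TTX \<Longrightarrow> m W = m W' \<Longrightarrow> a_hat W t = a_hat W' t"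
  by (simp add: T_struct_eq X)

lemma Ta_le_a_hat: "W \<in> TTX \<Longrightarrow> W' \<in> TTX \<Longrightarrow> m W = m W' \<Longrightarrow> Ta W t \<le> a_hat W' t"
  by (auto simp: T_struct_eq X intro: SUP_upper)

text \<open>
  This is the universal property of \<open>e x\<close> in \<open>TX\<close>: a left adjoint of \<open>e\<close> must represent \<open>a\<close>.
\<close>

lemma a_hat_eta:
  assumes "t \<in> TX" "x \<in> X"
  shows "a_hat (eta \<T> TX t) (e x) = a t x"
proof (rule antisym)
  show "a_hat (eta \<T> TX t) (e x) \<le> a t x"
  proof -
    have "Ta W (e x) \<le> a t x" if W: "W \<in> TTX" "m W = t" for W
    proof -
      have "Ta W (e x) \<le> tensor \<T> (Ta W (e x)) (a (e x) x)"
        using assms underlying_refl by (intro kunit_tensor_le) (simp add: underlying_eq[symmetric])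
      also have "\<dots> \<le> a t x"
        using a_trans[of W "e x" x] assms W by simp
      finally show ?thesis .
    qed
    then show ?thesis
      using assms by (auto simp: T_struct_eq X mu_eta intro: SUP_least)
  qed
  show "a t x \<le> a_hat (eta \<T> TX t) (e x)"
    using le_T_xi_eta[OF TX X, of t x a] Ta_le_a_hat[of "eta \<T> TX t" "eta \<T> TX t" "e x"] assms
    by (simp add: order_trans)
qed

lemma eta_functor: "T_functor \<T> X a TX a_hat e"
  unfolding T_functor_def
proof (intro conjI ballI)
  show "e \<in> X \<rightarrow> TX" by (rule eta_closed[OF X])
  fix t x assume "t \<in> TX" "x \<in> X"
  then show "a t x \<le> a_hat (Tmap \<T> X TX e t) (e x)"
    using a_hat_cong[of "Tmap \<T> X TX e t" "eta \<T> TX t"] a_hat_eta[of t x]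
    by (simp add: mu_eta mu_Tmap_eta X)
qed

lemma underlying_a_hat: "t \<in> TX \<Longrightarrow> underlying \<T> TX a_hat t s = a_hat (eta \<T> TX t) s"
  by (simp add: underlying_def rel_comp_map_rel)

text \<open>
  A left adjoint \<open>l\<close> of \<open>e\<close> is equivalent to \<open>\<alpha>\<close>: the unit of the adjunction says \<open>\<alpha> t \<le> l t\<close>,
  and the counit together with functoriality of \<open>l\<close> gives \<open>l t \<le> \<alpha> t\<close>. Functoriality of \<open>l\<close> at
  \<open>(W, m W)\<close> then becomes associativity of \<open>\<alpha>\<close>.
\<close>

lemma representable_imp_associative:
  assumes "representable \<T> X a"
  shows associative
proof -
  obtain l where l: "l \<in> TX \<rightarrow> X"
    and l_functor: "\<And>W t. W \<in> TTX \<Longrightarrow> t \<in> TX \<Longrightarrow> a_hat W t \<le> a (Tmap \<T> TX X l W) (l t)"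
    and unit: "\<And>t. t \<in> TX \<Longrightarrow> k \<le> underlying \<T> TX a_hat t (e (l t))"
    and counit: "\<And>x. x \<in> X \<Longrightarrow> k \<le> a\<^sub>0 (l (e x)) x"
    using assms
    by (auto simp: representable_def left_adjoint_def T_functor_def functor_le_def)
  have lmem [simp]: "l t \<in> X" if "t \<in> TX" for t using l that by blast
  have alpha_le_l: "k \<le> a\<^sub>0 (\<alpha> t) (l t)" if "t \<in> TX" for t
    using unit[OF that] that by (simp add: underlying_a_hat a_hat_eta a_eq)
  have l_le_alpha: "k \<le> a\<^sub>0 (l t) (\<alpha> t)" if t: "t \<in> TX" for t
  proof -
    have "k \<le> a_hat (eta \<T> TX t) (e (\<alpha> t))"
      using a_alpha t by (simp add: a_hat_eta)
    also have "\<dots> \<le> a (Tmap \<T> TX X l (eta \<T> TX t)) (l (e (\<alpha> t)))"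
      using t by (intro l_functor) auto
    also have "\<dots> = a\<^sub>0 (l t) (l (e (\<alpha> t)))"
      using t by (simp add: eta_natural[OF TX X l] underlying_eq)
    also have "\<dots> \<le> a\<^sub>0 (l t) (\<alpha> t)"
      using t by (intro underlying_mono counit) auto
    finally show ?thesis .
  qed
  show ?thesis
    unfolding associative_def
  proof
    fix W assume W: "W \<in> TTX"
    let ?Tl = "Tmap \<T> TX X l W"
    have Tl: "?Tl \<in> TX" using Tmap_closed[OF TX X l] W by blast
    have T\<alpha>_le_Tl: "k \<le> a\<^sub>0 (\<alpha> (T\<alpha> W)) (\<alpha> ?Tl)"
      using kunit_le_T_xi[OF TX X X alpha_closed l W, of a\<^sub>0] alpha_le_l
        T_xi_underlying_le[of "T\<alpha> W" ?Tl] W Tl by (simp add: order_trans)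
    \<comment> \<open>The lower bound \<open>k \<le> a_hat(W, m W)\<close> comes from \<open>Te(m W)\<close>, which \<open>m\<close> sends to \<open>m W\<close> as well.\<close>
    have "k \<le> Ta (Tmap \<T> X TX e (m W)) (m W)"
      using kunit_le_T_xi[OF X TX X eta_closed[OF X], of "\<lambda>x. x" "m W" a] W underlying_refl
      by (simp add: Tmap_id X underlying_eq)
    also have "\<dots> \<le> a_hat W (m W)"
      using W by (intro Ta_le_a_hat) (auto simp: mu_Tmap_eta X)
    also have "\<dots> \<le> a\<^sub>0 (\<alpha> ?Tl) (l (m W))"
      using l_functor[of W "m W"] W Tl by (simp add: a_eq)
    also have "\<dots> \<le> a\<^sub>0 (\<alpha> ?Tl) (\<alpha> (m W))"
      using W Tl by (intro underlying_mono l_le_alpha) auto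
    also have "\<dots> \<le> a\<^sub>0 (\<alpha> (T\<alpha> W)) (\<alpha> (m W))"
      using W Tl by (intro underlying_antimono T\<alpha>_le_Tl) auto
    finally show "k \<le> a\<^sub>0 (\<alpha> (T\<alpha> W)) (\<alpha> (m W))" .
  qed
qed

lemma associative_imp_representable:
  assumes associative
  shows "representable \<T> X a"
proof -
  have "a_hat W t \<le> a (T\<alpha> W) (\<alpha> t)" if W: "W \<in> TTX" and t: "t \<in> TX" for W t
  proof -
    have "Ta W' t \<le> a\<^sub>0 (\<alpha> (T\<alpha> W)) (\<alpha> t)" if W': "W' \<in> TTX" "m W' = m W" for W'
    proof -
      have "Ta W' t \<le> a\<^sub>0 (\<alpha> (T\<alpha> W')) (\<alpha> t)"
        using W' t by (intro Ta_le)
      also have "\<dots> \<le> a\<^sub>0 (\<alpha> (m W)) (\<alpha> t)"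
        using alpha_mu_le[of W'] W W' t by (intro underlying_antimono) auto
      also have "\<dots> \<le> a\<^sub>0 (\<alpha> (T\<alpha> W)) (\<alpha> t)"
        using assms W t by (intro underlying_antimono) (auto simp: associative_def)
      finally show ?thesis .
    qed
    then show ?thesis
      using W t by (auto simp: T_struct_eq X a_eq intro: SUP_least)
  qed
  then have "T_functor \<T> TX a_hat X a \<alpha>"
    by (simp add: T_functor_def alpha_closed)
  moreover have "functor_le \<T> TX TX a_hat (\<lambda>t. t) (\<lambda>t. e (\<alpha> t))"
    by (simp add: functor_le_def underlying_a_hat a_hat_eta a_alpha)
  moreover have "functor_le \<T> X X a (\<lambda>x. \<alpha> (e x)) (\<lambda>x. x)"
    by (simp add: functor_le_def alpha_eta)
  ultimately show ?thesis
    using eta_functor by (auto simp: representable_def left_adjoint_def)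
qed

end

theorem proposition2p15:
  fixes \<T> :: "('u, 'v::complete_lattice) topological_theory"
    and X :: "'u set" and a :: "('u, 'v) vrel" and \<alpha> :: "'u \<Rightarrow> 'u"
  assumes "topological_theory \<T>"
    and "bot \<noteq> kunit \<T>"
    and "T_category \<T> X a"
    and "\<alpha> \<in> Tob \<T> X \<rightarrow> X"
    and "rel_eq (Tob \<T> X) X a (rel_comp \<T> X (underlying \<T> X a) (map_rel \<T> \<alpha>))"
  shows "(T_category \<T> X (op_struct \<T> X a \<alpha>) \<longleftrightarrow> core_compact \<T> X a) \<and>
    (core_compact \<T> X a \<longleftrightarrow> representable \<T> X a)"
proof -
  interpret represented_category \<T> X a \<alpha>
    using assms by (intro represented_category.intro represented_category_axioms.intro)
  show ?thesis
    using T_category_op_iff core_compact_iff representable_imp_associative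
      associative_imp_representable by blast
qed

end
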